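(* Let $n\ge1$ and $k\ge0$ be integers such that $a_3(n)\neq0$ and $a_3(n+3^k)\neq0$. Then the map $$\alpha:\mathcal C_n\times\mathcal C_{n+3^k}\longrightarrow\mathcal C_{3n^2+(3^{k+1}+2)n+3^k}$$ defined for any $(x,y)\in\mathcal C_n$ and $(x',y')\in\mathcal C_{n+3^k}$ by $$\alpha((x,y),(x',y'))=(x+x'+3xx'+3xy'+3yx',\ y+y'-3xx'+3yy')$$ is well defined and is a bijection.
   Context: A $3$-core partition is an integer partition whose Young diagram has no hook of length $3$ (the hook of a box $b$ consists of $b$, the boxes to its right in its row and the boxes below it in its column; its hooklength is its number of boxes). The size of a partition is the sum of its parts, and $a_3(n)$ denotes the number of $3$-core partitions of size $n$. Characteristic vector of a $3$-core $\lambda$: for each diagonal box $d$ of the Young diagram, the arm at $d$ is the number of boxes in the same row strictly to the right of $d$, and the leg at $d$ is the number of boxes in the same column strictly below $d$. Let $\mathcal A_\lambda$ and $\mathcal L_\lambda$ be the sets of arms and of legs. For $i\in\{0,1,2\}$, if no element of $\mathcal L_\lambda$ is congruent to $2-i$ modulo $3$, set $c_i=|\{a\in\mathcal A_\lambda\mid a\equiv i \bmod 3\}|$; otherwise set $c_i=-|\{l\in\mathcal L_\lambda\mid l\equiv 2-i\bmod 3\}|$. The characteristic vector of $\lambda$ is $(c_0,c_1,c_2)$; it satisfies $c_0+c_1+c_2=0$ and is identified with the pair $(x,y)=(c_1,c_2)\in\mathbb Z^2$ (so $(c_0,c_1,c_2)=(-x-y,x,y)$). The map sending a $3$-core to its characteristic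 vector is a bijection from the set of all $3$-cores onto $\{(c_0,c_1,c_2)\in\mathbb Z^3\mid c_0+c_1+c_2=0\}$. $\mathcal C_n\subseteq\mathbb Z^2$ denotes the set of characteristic vectors $(x,y)$ of the $3$-core partitions of size $n$. *)

theory Defs
  imports "HOL-Number_Theory.Cong"
begin

definition integer_partition :: "nat list \<Rightarrow> bool" where
  "integer_partition \<mu> \<longleftrightarrow> sorted_wrt (\<ge>) \<mu> \<and> 0 \<notin> set \<mu>"

text \<open>Boxes are pairs (row, column), both counted from 0, with rows running downwards.\<close>

definition young_diagram :: "nat list \<Rightarrow> (nat \<times> nat) set" where
  "young_diagram \<mu> = {(i, j). i < length \<mu> \<and> j < \<mu> ! i}"

definition hook :: "nat list \<Rightarrow> nat \<times> nat \<Rightarrow> (nat \<times> nat) set" where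
  "hook \<mu> b = {(i, j) \<in> young_diagram \<mu>.
     (i = fst b \<and> snd b \<le> j) \<or> (j = snd b \<and> fst b \<le> i)}"

definition hooklength :: "nat list \<Rightarrow> nat \<times> nat \<Rightarrow> nat" where
  "hooklength \<mu> b = card (hook \<mu> b)"

definition core :: "nat \<Rightarrow> nat list \<Rightarrow> bool" where
  "core t \<mu> \<longleftrightarrow> integer_partition \<mu> \<and> (\<forall>b \<in> young_diagram \<mu>. hooklength \<mu> b \<noteq> t)"

definition cores_of_size :: "nat \<Rightarrow> nat \<Rightarrow> nat list set" where
  "cores_of_size t n = {\<mu>. core t \<mu> \<and> sum_list \<mu> = n}"

lemma finite_cores_of_size: "finite (cores_of_size t n)"
proof (rule finite_subset)
  have "length \<mu> \<le> sum_list \<mu>" if "0 \<notin> set \<mu>" for \<mu> :: "nat list"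
    using that by (induction \<mu>) auto
  then show "cores_of_size t n \<subseteq> {\<mu>. set \<mu> \<subseteq> {..n} \<and> length \<mu> \<le> n}"
    by (auto simp: cores_of_size_def core_def integer_partition_def intro: member_le_sum_list)
  show "finite {\<mu>. set \<mu> \<subseteq> {..n} \<and> length \<mu> \<le> n}"
    by (rule finite_lists_length_le) simp
qed

definition a3 :: "nat \<Rightarrow> nat" where
  "a3 n = card (cores_of_size 3 n)"

definition arm :: "nat list \<Rightarrow> nat \<times> nat \<Rightarrow> nat" where
  "arm \<mu> b = card {(i, j) \<in> young_diagram \<mu>. i = fst b \<and> snd b < j}"

definition leg :: "nat list \<Rightarrow> nat \<times> nat \<Rightarrow> nat" where
  "leg \<mu> b = card {(i, j) \<in> young_diagram \<mu>. j = snd b \<and> fst b < i}"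

definition diagonal_boxes :: "nat list \<Rightarrow> (nat \<times> nat) set" where
  "diagonal_boxes \<mu> = {(i, j) \<in> young_diagram \<mu>. i = j}"

definition arms :: "nat list \<Rightarrow> nat set" where
  "arms \<mu> = arm \<mu> ` diagonal_boxes \<mu>"

definition legs :: "nat list \<Rightarrow> nat set" where
  "legs \<mu> = leg \<mu> ` diagonal_boxes \<mu>"

text \<open>Only meaningful for \<open>i \<le> 2\<close>: the subtraction \<open>2 - i\<close> is on natural numbers.\<close>

definition char_coord :: "nat list \<Rightarrow> nat \<Rightarrow> int" where
  "char_coord \<mu> i =
     (if \<forall>l \<in> legs \<mu>. \<not> [l = 2 - i] (mod 3)
      then int (card {a \<in> arms \<mu>. [a = i] (mod 3)})
      else - int (card {l \<in> legs \<mu>. [l = 2 - i] (mod 3)}))"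

definition char_vector :: "nat list \<Rightarrow> int \<times> int \<times> int" where
  "char_vector \<mu> = (char_coord \<mu> 0, char_coord \<mu> 1, char_coord \<mu> 2)"

text \<open>Since the three coordinates sum to 0, the first one is redundant and is dropped.\<close>

definition char_vectors_of_size :: "nat \<Rightarrow> (int \<times> int) set" where
  "char_vectors_of_size n =
     {(x, y). \<exists>\<mu> \<in> cores_of_size 3 n. \<exists>c. char_vector \<mu> = (c, x, y)}"

end

theory Submission imports Defs begin

text \<open>
  A 3-core with characteristic vector \<open>(x, y)\<close> has size
  \<open>3 (x\<^sup>2 + x y + y\<^sup>2) + x + 2 y\<close>, and every pair of integers is the characteristic vector of a
  3-core. Hence the characteristic vectors for size \<open>n\<close> are the integer solutions of
  \<open>3 (x\<^sup>2 + x y + y\<^sup>2) + x + 2 y = n\<close>. Multiplying by 3 and adding 1 turns this equation into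
  \<open>a\<^sup>2 - a b + b\<^sup>2 = 3 n + 1\<close> with \<open>a = 3 y + 1\<close> and \<open>b = - 3 x\<close>: the solutions are the
  Eisenstein integers \<open>a + b \<omega>\<close> of norm \<open>3 n + 1\<close> that are congruent to 1 modulo 3. In these
  coordinates \<open>\<alpha>\<close> is multiplication, and
  \<open>(3 n + 1) (3 (n + 3^k) + 1) = 3 (3 n\<^sup>2 + (3^(k+1) + 2) n + 3^k) + 1\<close>.

  The two norms on the left differ by \<open>3^(k+1)\<close> and are prime to 3, so they are coprime. In the
  Eisenstein integers an element of norm \<open>A B\<close> with \<open>A\<close> and \<open>B\<close> coprime is a product of elements of
  norms \<open>A\<close> and \<open>B\<close> (\<open>factor_of_coprime_norms\<close>), unique up to a unit. The six units represent the six
  invertible classes modulo 3, so requiring both factors to be 1 modulo 3 fixes the unit, and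
  multiplication is a bijection (\<open>bij_betw_primary_mult\<close>).

  For the description of the characteristic vectors (\<open>char_vectors_of_size_eq\<close>) a partition is
  recorded by the set of its beads, the integers \<open>row i - i - 1\<close>, with the other integers as
  gaps. The arms of diagonal boxes are the nonnegative beads, the legs are the
  \<open>l \<ge> 0\<close> for which \<open>- 1 - l\<close> is a gap, and hooklengths are the differences between a bead and a smaller gap. A partition is therefore
  a 3-core exactly when its beads are closed under subtracting 3. On each of the three residue classes
  (runners) such a bead set is an initial segment, and the heights of the three segments are the
  coordinates of the characteristic vector.
\<close>

section \<open>Partitions and their beads\<close>

definition row :: "nat list \<Rightarrow> nat \<Rightarrow> nat" where
  "row \<mu> i = (if i < length \<mu> then \<mu> ! i else 0)"

definition column :: "nat list \<Rightarrow> nat \<Rightarrow> nat" where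
  "column \<mu> j = card {i. j < row \<mu> i}"

definition beads :: "nat list \<Rightarrow> int set" where
  "beads \<mu> = range (\<lambda>i. int (row \<mu> i) - int i - 1)"

lemma young_diagram_iff: "(i, j) \<in> young_diagram \<mu> \<longleftrightarrow> j < row \<mu> i"
  by (simp add: young_diagram_def row_def)

lemma row_antimono:
  assumes "integer_partition \<mu>" "i \<le> i'"
  shows "row \<mu> i' \<le> row \<mu> i"
  using assms sorted_wrt_nth_less[of "(\<ge>)" \<mu> i i']
  by (cases "i = i'") (auto simp: row_def integer_partition_def)

text \<open>Rows weakly decrease, so the rows reaching beyond column \<open>j\<close> form an initial segment of the
  naturals, and its length is \<open>column \<mu> j\<close>. This symmetry lets every statement about
  columns be read off from rows.\<close>

lemma less_row_iff_less_column:
  assumes "integer_partition \<mu>"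
  shows "j < row \<mu> i \<longleftrightarrow> i < column \<mu> j"
proof -
  have initial: "{i. j < row \<mu> i} = {..<card {i. j < row \<mu> i}}"
  proof -
    let ?S = "{i. j < row \<mu> i}"
    define m where "m = (LEAST i. \<not> j < row \<mu> i)"
    have m: "\<not> j < row \<mu> m"
      unfolding m_def by (rule LeastI[of _ "length \<mu>"]) (simp add: row_def)
    have "?S = {..<m}"
    proof (intro equalityI subsetI)
      fix i assume "i \<in> ?S"
      then show "i \<in> {..<m}"
        using m row_antimono[OF assms, of m i] by (auto intro: leI simp: not_less[symmetric])
    qed (use not_less_Least in \<open>auto simp: m_def\<close>)
    then show ?thesis by simp
  qed
  show ?thesis
    unfolding column_def using initial by blast
qed

context
  fixes \<mu> :: "nat list"
  assumes partition: "integer_partition \<mu>"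
begin

lemma arm_eq: "arm \<mu> (i, j) = row \<mu> i - j - 1"
proof -
  have "{(i', j') \<in> young_diagram \<mu>. i' = i \<and> j < j'} = {i} \<times> {j<..<row \<mu> i}"
    by (auto simp: young_diagram_iff)
  then show ?thesis
    by (simp add: arm_def)
qed

lemma leg_eq: "leg \<mu> (i, j) = column \<mu> j - i - 1"
proof -
  have "{(i', j') \<in> young_diagram \<mu>. j' = j \<and> i < i'} = {i<..<column \<mu> j} \<times> {j}"
    by (auto simp: young_diagram_iff less_row_iff_less_column[OF partition])
  then show ?thesis
    by (simp add: leg_def)
qed

lemma hooklength_eq_arm_leg:
  assumes "j < row \<mu> i"
  shows "hooklength \<mu> (i, j) = arm \<mu> (i, j) + leg \<mu> (i, j) + 1"
proof -
  have "hook \<mu> (i, j) = {i} \<times> {j..<row \<mu> i} \<union> {i<..<column \<mu> j} \<times> {j}"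
    using assms
    by (auto simp: hook_def young_diagram_iff less_row_iff_less_column[OF partition])
  moreover have "card ({i} \<times> {j..<row \<mu> i} \<union> {i<..<column \<mu> j} \<times> {j})
      = (row \<mu> i - j) + (column \<mu> j - i - 1)"
    by (subst card_Un_disjoint) auto
  ultimately show ?thesis
    using assms by (simp add: hooklength_def arm_eq leg_eq)
qed

lemma hooklength_eq:
  assumes "j < row \<mu> i"
  shows "int (hooklength \<mu> (i, j)) = (int (row \<mu> i) - int i - 1) - (int j - int (column \<mu> j))"
  using assms less_row_iff_less_column[OF partition, of j i]
  by (simp add: hooklength_eq_arm_leg arm_eq leg_eq)

text \<open>Walk along the boundary of the diagram from bottom left to top right. Each unit step is either
  vertical, ending a row (a bead), or horizontal, ending a column (a gap), and consecutive steps have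
  consecutive positions. So the integers \<open>j - column \<mu> j\<close> are exactly those missed by the beads.\<close>

lemma gaps_eq: "- beads \<mu> = range (\<lambda>j. int j - int (column \<mu> j))"
proof (intro equalityI subsetI)
  fix z assume z: "z \<in> - beads \<mu>"
  let ?P = "\<lambda>i. int (row \<mu> i) - int i - 1 \<le> z"
  have "?P (length \<mu> + nat (- z))"
    by (simp add: row_def)
  \<comment> \<open>The row above which the boundary passes position \<open>z\<close>; the step there is horizontal, in column \<open>z + i\<close>.\<close>
  define i where "i = (LEAST i. ?P i)"
  have i: "?P i"
    unfolding i_def by (rule LeastI) fact
  moreover have "int (row \<mu> i) - int i - 1 \<noteq> z"
    using z by (auto simp: beads_def)
  ultimately have less: "int (row \<mu> i) - int i - 1 < z"
    by simp
  define j where "j = nat (z + int i)"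
  have j: "int j = z + int i"
    using less by (simp add: j_def)
  have "\<not> i < column \<mu> j"
    using less j by (simp flip: less_row_iff_less_column[OF partition])
  moreover have "i' < column \<mu> j" if "i = Suc i'" for i'
  proof -
    have "\<not> ?P i'"
      using not_less_Least[of i' ?P] that by (simp add: i_def)
    then show ?thesis
      using j that by (simp flip: less_row_iff_less_column[OF partition])
  qed
  ultimately have "column \<mu> j = i"
    by (cases i) (auto intro: antisym simp: Suc_le_eq not_less)
  then have "z = int j - int (column \<mu> j)"
    using j by simp
  then show "z \<in> range (\<lambda>j. int j - int (column \<mu> j))"
    by blast
next
  fix z assume "z \<in> range (\<lambda>j. int j - int (column \<mu> j))"
  then obtain j where j: "z = int j - int (column \<mu> j)" by blast
  have "z \<noteq> int (row \<mu> i) - int i - 1" for i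
    using less_row_iff_less_column[OF partition, of j i]
    by (cases "j < row \<mu> i") (auto simp: j)
  then show "z \<in> - beads \<mu>"
    unfolding beads_def by blast
qed

text \<open>By \<open>hooklength_eq\<close> each hooklength is a bead minus a smaller gap. Conversely a bead
  larger than a gap meets it in a box of the diagram, so a hook of length \<open>t\<close> is a bead \<open>x\<close>
  with a gap at \<open>x - t\<close>.\<close>

lemma core_iff_beads: "core t \<mu> \<longleftrightarrow> t = 0 \<or> (\<forall>x \<in> beads \<mu>. x - int t \<in> beads \<mu>)"
proof -
  have "(\<exists>b \<in> young_diagram \<mu>. hooklength \<mu> b = t) \<longleftrightarrow>
        t \<noteq> 0 \<and> (\<exists>x \<in> beads \<mu>. x - int t \<in> - beads \<mu>)" (is "?L \<longleftrightarrow> ?R")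
  proof
    assume ?L
    then obtain i j where ij: "j < row \<mu> i" "hooklength \<mu> (i, j) = t"
      by (auto simp: young_diagram_iff)
    have "t \<noteq> 0"
      using ij by (auto simp: hooklength_eq_arm_leg)
    moreover have "(int (row \<mu> i) - int i - 1) - int t = int j - int (column \<mu> j)"
      using hooklength_eq[OF ij(1)] ij(2) by simp
    ultimately show ?R
      unfolding gaps_eq by (auto simp: beads_def)
  next
    assume ?R
    then obtain i j where "t \<noteq> 0"
      and eq: "(int (row \<mu> i) - int i - 1) - int t = int j - int (column \<mu> j)"
      unfolding gaps_eq by (auto simp: beads_def)
    then have box: "j < row \<mu> i"
      using less_row_iff_less_column[OF partition, of j i] by linarith
    then have "hooklength \<mu> (i, j) = t"
      using hooklength_eq[OF box] eq by simp
    then show ?L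
      using box by (auto simp: young_diagram_iff)
  qed
  then show ?thesis
    using partition by (auto simp: core_def)
qed

lemma diagonal_boxes_eq: "diagonal_boxes \<mu> = (\<lambda>i. (i, i)) ` {i. i < row \<mu> i}"
  by (auto simp: diagonal_boxes_def young_diagram_iff)

lemma arms_eq: "arms \<mu> = {a. int a \<in> beads \<mu>}"
proof -
  have "int a \<in> beads \<mu> \<longleftrightarrow> (\<exists>i. i < row \<mu> i \<and> a = row \<mu> i - i - 1)" for a
    unfolding beads_def image_iff by (simp add: Bex_def) (intro ex_cong1, linarith)
  then show ?thesis
    by (auto simp: arms_def diagonal_boxes_eq image_image arm_eq)
qed

lemma legs_eq: "legs \<mu> = {l. - 1 - int l \<notin> beads \<mu>}"
proof -
  have "- 1 - int l \<in> - beads \<mu> \<longleftrightarrow> (\<exists>i. i < column \<mu> i \<and> l = column \<mu> i - i - 1)" for l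
    unfolding gaps_eq image_iff by (simp add: Bex_def) (intro ex_cong1, linarith)
  then show ?thesis
    by (auto simp: legs_def diagonal_boxes_eq image_image leg_eq
        less_row_iff_less_column[OF partition])
qed

lemma finite_diagonal: "finite {i. i < row \<mu> i}"
  by (rule finite_subset[of _ "{..<length \<mu>}"]) (auto simp: row_def split: if_splits)

lemma inj_on_diagonal:
  "inj_on (\<lambda>i. arm \<mu> (i, i)) {i. i < row \<mu> i}"
  "inj_on (\<lambda>i. leg \<mu> (i, i)) {i. i < row \<mu> i}"
proof -
  have "arm \<mu> (i', i') < arm \<mu> (i, i)"
    if "i < i'" "i' < row \<mu> i'" for i i'
    using that row_antimono[OF partition, of i i'] by (simp add: arm_eq)
  then show "inj_on (\<lambda>i. arm \<mu> (i, i)) {i. i < row \<mu> i}"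
    by (intro linorder_inj_onI') (metis less_irrefl mem_Collect_eq)
  have "leg \<mu> (i', i') < leg \<mu> (i, i)"
    if "i < i'" "i' < row \<mu> i'" for i i'
  proof -
    have "column \<mu> i' - 1 < column \<mu> i" if "column \<mu> i' > 0"
      using that less_row_iff_less_column[OF partition, of i "column \<mu> i' - 1"]
        less_row_iff_less_column[OF partition, of i' "column \<mu> i' - 1"] \<open>i < i'\<close> by simp
    moreover have "i' < column \<mu> i'"
      using that by (simp flip: less_row_iff_less_column[OF partition])
    ultimately show ?thesis
      using that by (simp add: leg_eq)
  qed
  then show "inj_on (\<lambda>i. leg \<mu> (i, i)) {i. i < row \<mu> i}"
    by (intro linorder_inj_onI') (metis less_irrefl mem_Collect_eq)
qed

lemma card_arms_eq_card_legs: "card (arms \<mu>) = card (legs \<mu>)"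
  using inj_on_diagonal
  by (simp add: arms_def legs_def diagonal_boxes_eq image_image card_image)

text \<open>The hooks of the diagonal boxes partition the diagram: the box \<open>(i, j)\<close> belongs to the hook of
  the diagonal box at \<open>min i j\<close>. The factor 2 splits each hooklength
  \<open>arm + leg + 1\<close> evenly between its arm and its leg without fractions.\<close>

lemma sum_list_eq_arms_legs:
  "2 * sum_list \<mu> = (\<Sum>a\<in>arms \<mu>. 2 * a + 1) + (\<Sum>l\<in>legs \<mu>. 2 * l + 1)"
proof -
  let ?D = "{i. i < row \<mu> i}"
  have diagram: "young_diagram \<mu> = (SIGMA i:{..<length \<mu>}. {..<\<mu> ! i})"
    by (auto simp: young_diagram_def)
  have "sum_list \<mu> = card (young_diagram \<mu>)"
    by (simp add: diagram sum_list_sum_nth atLeast0LessThan)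
  also have "young_diagram \<mu> = (\<Union>i\<in>?D. hook \<mu> (i, i))"
  proof (intro equalityI subsetI)
    fix b assume "b \<in> young_diagram \<mu>"
    then obtain i j where b: "b = (i, j)" and ij: "j < row \<mu> i" "i < column \<mu> j"
      by (cases b) (auto simp: young_diagram_iff less_row_iff_less_column[OF partition])
    have "min i j < row \<mu> (min i j)"
      using ij row_antimono[OF partition, of "min i j" i] by linarith
    then show "b \<in> (\<Union>i\<in>?D. hook \<mu> (i, i))"
      using b ij by (intro UN_I[of "min i j"]) (auto simp: hook_def young_diagram_iff min_def)
  qed (auto simp: hook_def)
  also have "card \<dots> = (\<Sum>i\<in>?D. hooklength \<mu> (i, i))"
    unfolding hooklength_def
  proof (rule card_UN_disjoint)
    show "\<forall>i\<in>?D. finite (hook \<mu> (i, i))"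
    proof
      fix i
      have "finite (young_diagram \<mu>)"
        by (simp add: diagram)
      then show "finite (hook \<mu> (i, i))"
        by (rule finite_subset[rotated]) (auto simp: hook_def)
    qed
  qed (use finite_diagonal in \<open>auto simp: hook_def\<close>)
  also have "\<dots> = (\<Sum>i\<in>?D. arm \<mu> (i, i) + leg \<mu> (i, i) + 1)"
    by (rule sum.cong) (auto simp: hooklength_eq_arm_leg)
  finally have "2 * sum_list \<mu> = (\<Sum>i\<in>?D. 2 * arm \<mu> (i, i) + 1) + (\<Sum>i\<in>?D. 2 * leg \<mu> (i, i) + 1)"
    by (simp add: sum_distrib_left flip: sum.distrib)
  also have "(\<Sum>i\<in>?D. 2 * arm \<mu> (i, i) + 1) = (\<Sum>a\<in>arms \<mu>. 2 * a + 1)"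
    using inj_on_diagonal(1)
    by (simp add: arms_def diagonal_boxes_eq image_image sum.reindex)
  also have "(\<Sum>i\<in>?D. 2 * leg \<mu> (i, i) + 1) = (\<Sum>l\<in>legs \<mu>. 2 * l + 1)"
    using inj_on_diagonal(2)
    by (simp add: legs_def diagonal_boxes_eq image_image sum.reindex)
  finally show ?thesis .
qed

end

section \<open>Three-cores and characteristic vectors\<close>

text \<open>The bead sets closed under subtracting 3. Position \<open>m\<close> on runner \<open>i\<close> is the
  integer \<open>i + 3 m\<close>, and runner \<open>i\<close> is filled at all positions below \<open>c i\<close>.\<close>

definition abacus :: "(nat \<Rightarrow> int) \<Rightarrow> int set" where
  "abacus c = {z. z div 3 < c (nat (z mod 3))}"

lemma mem_abacus_iff: "i < 3 \<Longrightarrow> int i + 3 * m \<in> abacus c \<longleftrightarrow> m < c i"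
  by (simp add: abacus_def)

lemma downward_closed_int_set:
  fixes P :: "int \<Rightarrow> bool"
  assumes down: "\<And>m. P m \<Longrightarrow> P (m - 1)" and lo: "P lo" and hi: "\<not> P hi"
  shows "\<exists>c. \<forall>m. P m \<longleftrightarrow> m < c"
proof -
  have down': "P (m - int k)" if "P m" for m k
  proof (induction k)
    case (Suc k)
    then show ?case
      using down[of "m - int k"] by (simp add: algebra_simps)
  qed (use that in simp)
  have down'': "P m'" if "P m" "m' \<le> m" for m m'
    using down'[OF that(1), of "nat (m - m')"] that(2) by simp
  have "lo < hi"
    using down''[of lo hi] lo hi by (meson not_le_imp_less)
  define k where "k = (LEAST k. \<not> P (lo + int k))"
  have k: "\<not> P (lo + int k)"
    unfolding k_def by (rule LeastI[of _ "nat (hi - lo)"]) (use hi \<open>lo < hi\<close> in simp)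
  have "k \<noteq> 0"
    using k lo by (metis add.right_neutral of_nat_0)
  then have "P (lo + int (k - 1))"
    using not_less_Least[of "k - 1" "\<lambda>k. \<not> P (lo + int k)"] by (simp add: k_def)
  then have "P (lo + int k - 1)"
    using \<open>k \<noteq> 0\<close> by (simp add: of_nat_diff algebra_simps)
  then have "P m \<longleftrightarrow> m < lo + int k" for m
    using down''[of "lo + int k - 1" m] down''[of m "lo + int k"] k by fastforce
  then show ?thesis by blast
qed

lemma core_3_beads_eq_abacus:
  assumes "core 3 \<mu>"
  obtains c where "beads \<mu> = abacus c"
proof -
  have partition: "integer_partition \<mu>"
    using assms by (simp add: core_def)
  have closed: "x - 3 \<in> beads \<mu>" if "x \<in> beads \<mu>" for x
    using assms that core_iff_beads[OF partition, of 3] by simp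
  have "\<exists>c. \<forall>m. int i + 3 * m \<in> beads \<mu> \<longleftrightarrow> m < c" for i
  proof -
    have low: "z \<in> beads \<mu>" if "z \<le> - int (length \<mu>) - 1" for z
      unfolding beads_def using that by (intro image_eqI[of _ _ "nat (- z - 1)"]) (auto simp: row_def)
    have high: "z \<notin> beads \<mu>" if "z \<ge> int (row \<mu> 0)" for z
    proof
      assume "z \<in> beads \<mu>"
      then obtain k where "z = int (row \<mu> k) - int k - 1"
        by (auto simp: beads_def)
      then show False
        using that row_antimono[OF partition, of 0 k] by simp
    qed
    have "int i + 3 * (m - 1) \<in> beads \<mu>" if "int i + 3 * m \<in> beads \<mu>" for m
      using closed[OF that] by (simp add: algebra_simps)
    moreover have "int i + 3 * (- int i - int (length \<mu>) - 1) \<in> beads \<mu>"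
      by (rule low) simp
    moreover have "int i + 3 * int (row \<mu> 0) \<notin> beads \<mu>"
      by (rule high) simp
    ultimately show ?thesis
      by (rule downward_closed_int_set)
  qed
  then obtain c where c: "\<And>i m. int i + 3 * m \<in> beads \<mu> \<longleftrightarrow> m < c i"
    by metis
  have "z \<in> beads \<mu> \<longleftrightarrow> z \<in> abacus c" for z
    using c[of "nat (z mod 3)" "z div 3"] by (simp add: abacus_def)
  then show thesis
    using that by blast
qed

text \<open>Arms and legs in terms of an arbitrary set of beads, so that the counting on the three runners can be
  used before a partition with these beads has been constructed.\<close>

definition bead_arms :: "int set \<Rightarrow> nat set" where
  "bead_arms X = {a. int a \<in> X}"

definition bead_legs :: "int set \<Rightarrow> nat set" where
  "bead_legs X = {l. - 1 - int l \<notin> X}"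

lemma bead_arms_runner:
  assumes "i < 3"
  shows "{a \<in> bead_arms (abacus c). [a = i] (mod 3)} = (\<lambda>m. i + 3 * m) ` {..<nat (c i)}"
proof (intro equalityI subsetI)
  fix a assume a: "a \<in> {a \<in> bead_arms (abacus c). [a = i] (mod 3)}"
  then have "a mod 3 = i"
    using assms by (simp add: cong_def)
  then have "a = i + 3 * (a div 3)"
    by presburger
  moreover from this have "int (a div 3) < c i"
    using a mem_abacus_iff[OF assms, of "int (a div 3)" c]
    by (simp add: bead_arms_def) (metis of_nat_add of_nat_mult of_nat_numeral)
  ultimately show "a \<in> (\<lambda>m. i + 3 * m) ` {..<nat (c i)}"
    by (intro image_eqI) auto
next
  fix a assume "a \<in> (\<lambda>m. i + 3 * m) ` {..<nat (c i)}"
  then obtain m where "a = i + 3 * m" "int m < c i"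
    by auto
  then show "a \<in> {a \<in> bead_arms (abacus c). [a = i] (mod 3)}"
    using mem_abacus_iff[OF assms, of "int m" c] by (simp add: bead_arms_def cong_def)
qed

text \<open>Reflection \<open>l \<mapsto> - 1 - l\<close> carries the residue class of \<open>2 - i\<close> to that of \<open>i\<close>;
  this is why the legs congruent to \<open>2 - i\<close> are paired with the arms congruent to \<open>i\<close>
  in the characteristic vector.\<close>

lemma bead_legs_runner:
  assumes "i < 3"
  shows "{l \<in> bead_legs (abacus c). [l = 2 - i] (mod 3)} = (\<lambda>m. 2 - i + 3 * m) ` {..<nat (- c i)}"
proof -
  have mem: "2 - i + 3 * m \<in> bead_legs (abacus c) \<longleftrightarrow> int m < - c i" for m
  proof -
    have eq: "- 1 - int (2 - i + 3 * m) = int i + 3 * (- 1 - int m)"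
      using assms by simp
    show ?thesis
      unfolding bead_legs_def mem_Collect_eq eq mem_abacus_iff[OF assms] by linarith
  qed
  show ?thesis
  proof (intro equalityI subsetI)
    fix l assume l: "l \<in> {l \<in> bead_legs (abacus c). [l = 2 - i] (mod 3)}"
    then have "l mod 3 = 2 - i"
      using assms by (simp add: cong_def)
    then have "l = 2 - i + 3 * (l div 3)"
      by presburger
    moreover from this have "int (l div 3) < - c i"
      using l mem[of "l div 3"] by simp
    ultimately show "l \<in> (\<lambda>m. 2 - i + 3 * m) ` {..<nat (- c i)}"
      by (intro image_eqI) auto
  next
    fix l assume "l \<in> (\<lambda>m. 2 - i + 3 * m) ` {..<nat (- c i)}"
    then obtain m where m: "l = 2 - i + 3 * m" "int m < - c i"
      by auto
    have "[l = 2 - i] (mod 3)"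
      unfolding m(1) cong_def by (rule mod_mult_self2)
    then show "l \<in> {l \<in> bead_legs (abacus c). [l = 2 - i] (mod 3)}"
      using m mem by simp
  qed
qed

lemma runner_card: "card ((\<lambda>m. j + 3 * m) ` {..<N}) = N" for j :: nat
  by (simp add: card_image inj_on_def)

text \<open>On runner \<open>i\<close> there are either arms (when \<open>c i > 0\<close>) or legs (when
  \<open>c i < 0\<close>), never both, and in each case their number is the absolute value of \<open>c i\<close>.\<close>

lemma char_coord_abacus:
  assumes "integer_partition \<mu>" "beads \<mu> = abacus c" "i < 3"
  shows "char_coord \<mu> i = c i"
proof -
  have arms: "{a \<in> arms \<mu>. [a = i] (mod 3)} = (\<lambda>m. i + 3 * m) ` {..<nat (c i)}"
    using bead_arms_runner[OF assms(3)] assms(2)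
    by (simp add: arms_eq[OF assms(1)] bead_arms_def)
  have legs: "{l \<in> legs \<mu>. [l = 2 - i] (mod 3)} = (\<lambda>m. 2 - i + 3 * m) ` {..<nat (- c i)}"
    using bead_legs_runner[OF assms(3)] assms(2)
    by (simp add: legs_eq[OF assms(1)] bead_legs_def)
  have "(\<forall>l \<in> legs \<mu>. \<not> [l = 2 - i] (mod 3)) \<longleftrightarrow> {l \<in> legs \<mu>. [l = 2 - i] (mod 3)} = {}"
    by blast
  also have "\<dots> \<longleftrightarrow> c i \<ge> 0"
    by (auto simp: legs lessThan_empty_iff)
  finally show ?thesis
    unfolding char_coord_def arms legs by (simp add: runner_card)
qed

lemma sum_residue_classes:
  fixes f :: "nat \<Rightarrow> int"
  assumes "finite S"
  shows "sum f S = (\<Sum>i<3. sum f {a \<in> S. [a = i] (mod 3)})"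
proof -
  have "S = (\<Union>i<3. {a \<in> S. [a = i] (mod 3)})"
    by (auto simp: cong_def intro!: bexI[of _ "_ mod 3"])
  also have "sum f \<dots> = (\<Sum>i<3. sum f {a \<in> S. [a = i] (mod 3)})"
    using assms by (subst sum.UNION_disjoint) (auto simp: cong_def)
  finally show ?thesis .
qed

lemma runner_sum:
  "(\<Sum>a\<in>(\<lambda>m. j + 3 * m) ` {..<N}. int (2 * a + 1)) = 3 * (int N)\<^sup>2 + 2 * (int j - 1) * int N"
proof -
  have "(\<Sum>a\<in>(\<lambda>m. j + 3 * m) ` {..<N}. int (2 * a + 1)) = (\<Sum>m<N. 2 * (int j + 3 * int m) + 1)"
    by (subst sum.reindex) (auto simp: inj_on_def intro!: sum.cong)
  also have "\<dots> = 3 * (int N)\<^sup>2 + 2 * (int j - 1) * int N"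
    by (induction N) (simp_all add: power2_eq_square algebra_simps)
  finally show ?thesis .
qed

lemma finite_bead_arms_legs: "finite (bead_arms (abacus c))" "finite (bead_legs (abacus c))"
proof -
  have "bead_arms (abacus c) = (\<Union>i<3. {a \<in> bead_arms (abacus c). [a = i] (mod 3)})"
    by (auto simp: cong_def intro!: bexI[of _ "_ mod 3"])
  also have "finite \<dots>"
    by (auto simp: bead_arms_runner)
  finally show "finite (bead_arms (abacus c))" .
  have "bead_legs (abacus c) = (\<Union>i<3. {l \<in> bead_legs (abacus c). [l = 2 - i] (mod 3)})"
  proof -
    have "\<exists>i<3. [l = 2 - i] (mod 3)" for l :: nat
      by (intro exI[of _ "2 - l mod 3"]) (auto simp: cong_def; presburger)
    then show ?thesis by blast
  qed
  also have "finite \<dots>"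
    by (auto simp: bead_legs_runner)
  finally show "finite (bead_legs (abacus c))" .
qed

lemma sum_nat_lessThan_3: "(\<Sum>i<3. f i) = f 0 + f 1 + f (2::nat)"
  for f :: "nat \<Rightarrow> int"
  by (simp add: eval_nat_numeral)

lemma charge_abacus:
  "int (card (bead_arms (abacus c))) - int (card (bead_legs (abacus c))) = c 0 + c 1 + c 2"
proof -
  have "int (card (bead_arms (abacus c))) = (\<Sum>a\<in>bead_arms (abacus c). 1)"
    by simp
  also have "\<dots> = (\<Sum>i<3. \<Sum>a\<in>{a \<in> bead_arms (abacus c). [a = i] (mod 3)}. 1)"
    by (rule sum_residue_classes[OF finite_bead_arms_legs(1)])
  also have "\<dots> = (\<Sum>i<3. int (nat (c i)))"
    by (rule sum.cong)
      (simp_all only: bead_arms_runner lessThan_iff sum_constant runner_card mult_1_right)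
  finally have arms: "int (card (bead_arms (abacus c))) = (\<Sum>i<3. int (nat (c i)))" .
  have "int (card (bead_legs (abacus c))) = (\<Sum>l\<in>bead_legs (abacus c). 1)"
    by simp
  also have "\<dots> = (\<Sum>i<3. \<Sum>l\<in>{l \<in> bead_legs (abacus c). [l = i] (mod 3)}. 1)"
    by (rule sum_residue_classes[OF finite_bead_arms_legs(2)])
  also have "\<dots> = (\<Sum>i<3. \<Sum>l\<in>{l \<in> bead_legs (abacus c). [l = 2 - i] (mod 3)}. 1)"
    by (simp only: sum_nat_lessThan_3) simp
  also have "\<dots> = (\<Sum>i<3. int (nat (- c i)))"
    by (rule sum.cong)
      (simp_all only: bead_legs_runner lessThan_iff sum_constant runner_card mult_1_right)
  finally show ?thesis
    using arms unfolding sum_nat_lessThan_3 by linarith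
qed

text \<open>On runner \<open>i\<close> the arms and legs are arithmetic progressions with difference 3, and replacing
  arms by legs changes the signs of both \<open>c i\<close> and \<open>i - 1\<close>. So one quadratic polynomial
  covers both signs of \<open>c i\<close>.\<close>

lemma weight_abacus:
  "(\<Sum>a\<in>bead_arms (abacus c). int (2 * a + 1)) + (\<Sum>l\<in>bead_legs (abacus c). int (2 * l + 1))
   = (\<Sum>i<3. 3 * (c i)\<^sup>2 + 2 * (int i - 1) * c i)"
proof -
  let ?w = "\<lambda>a. int (2 * a + 1)"
  have "sum ?w (bead_arms (abacus c)) =
        (\<Sum>i<3. sum ?w {a \<in> bead_arms (abacus c). [a = i] (mod 3)})"
    by (rule sum_residue_classes[OF finite_bead_arms_legs(1)])
  also have "\<dots> = (\<Sum>i<3. 3 * (int (nat (c i)))\<^sup>2 + 2 * (int i - 1) * int (nat (c i)))"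
    by (rule sum.cong) (simp_all only: bead_arms_runner lessThan_iff runner_sum)
  finally have arms: "sum ?w (bead_arms (abacus c)) = \<dots>" .
  have "sum ?w (bead_legs (abacus c)) =
        (\<Sum>i<3. sum ?w {l \<in> bead_legs (abacus c). [l = i] (mod 3)})"
    by (rule sum_residue_classes[OF finite_bead_arms_legs(2)])
  also have "\<dots> = (\<Sum>i<3. sum ?w {l \<in> bead_legs (abacus c). [l = 2 - i] (mod 3)})"
    by (simp only: sum_nat_lessThan_3) simp
  also have "\<dots> = (\<Sum>i<3. 3 * (int (nat (- c i)))\<^sup>2 + 2 * (int (2 - i) - 1) * int (nat (- c i)))"
    by (rule sum.cong) (simp_all only: bead_legs_runner lessThan_iff runner_sum)
  finally have legs: "sum ?w (bead_legs (abacus c)) = \<dots>" .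
  have runner: "3 * (int (nat (c i)))\<^sup>2 + 2 * (int i - 1) * int (nat (c i)) +
      (3 * (int (nat (- c i)))\<^sup>2 + 2 * (int (2 - i) - 1) * int (nat (- c i)))
      = 3 * (c i)\<^sup>2 + 2 * (int i - 1) * c i" if "i < 3" for i
  proof -
    have "int (2 - i) - 1 = - (int i - 1)"
      using that by simp
    then show ?thesis
      by (cases "c i \<ge> 0") (simp_all add: algebra_simps)
  qed
  show ?thesis
    unfolding arms legs sum.distrib[symmetric] by (rule sum.cong) (use runner in auto)
qed

text \<open>A partition has as many arms as legs, which forces the three runner heights to add up to 0; the
  size is half the weight of the abacus.\<close>

lemma core_3_char_vector:
  assumes "core 3 \<mu>" "char_vector \<mu> = (c0, x, y)"
  shows "c0 = - x - y" "int (sum_list \<mu>) = 3 * (x\<^sup>2 + x * y + y\<^sup>2) + x + 2 * y"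
proof -
  have partition: "integer_partition \<mu>"
    using assms by (simp add: core_def)
  obtain c where c: "beads \<mu> = abacus c"
    using core_3_beads_eq_abacus[OF assms(1)] .
  have coords: "c 0 = c0" "c 1 = x" "c 2 = y"
    using assms(2) char_coord_abacus[OF partition c] by (auto simp: char_vector_def)
  have arms: "arms \<mu> = bead_arms (abacus c)" and legs: "legs \<mu> = bead_legs (abacus c)"
    by (simp_all add: arms_eq[OF partition] legs_eq[OF partition] bead_arms_def bead_legs_def c)
  have "c 0 + c 1 + c 2 = 0"
    using charge_abacus[of c] card_arms_eq_card_legs[OF partition] by (simp add: arms legs)
  then show c0: "c0 = - x - y"
    unfolding coords by linarith
  have "2 * int (sum_list \<mu>) = (\<Sum>i<3. 3 * (c i)\<^sup>2 + 2 * (int i - 1) * c i)"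
    using arg_cong[OF sum_list_eq_arms_legs[OF partition], of int] weight_abacus[of c]
    by (simp add: arms legs)
  also have "\<dots> = 3 * c0\<^sup>2 - 2 * c0 + 3 * x\<^sup>2 + 3 * y\<^sup>2 + 2 * y"
    by (simp only: sum_nat_lessThan_3 coords) simp
  also have "\<dots> = 2 * (3 * (x\<^sup>2 + x * y + y\<^sup>2) + x + 2 * y)"
    by (simp add: c0 power2_eq_square algebra_simps)
  finally show "int (sum_list \<mu>) = 3 * (x\<^sup>2 + x * y + y\<^sup>2) + x + 2 * y"
    by simp
qed

text \<open>Let \<open>- N\<close> be the smallest gap of \<open>X\<close>. Because arms and legs are equinumerous, there are
  exactly \<open>N\<close> beads above this gap. Listing them in decreasing order as \<open>xs\<close>, the parts must
  be \<open>xs ! i + i + 1\<close>, and the remaining beads, all integers below \<open>- N\<close>, are those of the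
  empty rows. That \<open>- N\<close> is a gap makes the last part positive.\<close>

lemma partition_of_neutral_beads:
  assumes fin: "finite (bead_arms X)" "finite (bead_legs X)"
    and neutral: "card (bead_arms X) = card (bead_legs X)"
  obtains \<mu> where "integer_partition \<mu>" "beads \<mu> = X"
proof -
  \<comment> \<open>The number of parts.\<close>
  define N where "N = (LEAST N. \<forall>z < - int N. z \<in> X)"
  obtain B where B: "\<And>l. l \<in> bead_legs X \<Longrightarrow> l < B"
    by (metis fin(2) finite_nat_set_iff_bounded)
  have "\<forall>z < - int B. z \<in> X"
  proof (intro allI impI)
    fix z assume "z < - int B"
    then have "nat (- 1 - z) \<notin> bead_legs X" "- 1 - int (nat (- 1 - z)) = z"
      using B[of "nat (- 1 - z)"] by auto
    then show "z \<in> X"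
      by (simp add: bead_legs_def)
  qed
  then have "\<forall>z < - int N. z \<in> X"
    unfolding N_def by (rule LeastI[of _ B])
  then have low: "z \<in> X" if "z < - int N" for z
    using that by blast
  have gap: "- int N \<notin> X"
  proof (cases N)
    case 0
    have "bead_legs X = {}"
      using low by (auto simp: 0 bead_legs_def)
    then have "bead_arms X = {}"
      using neutral fin by simp
    then show ?thesis
      unfolding bead_arms_def by (metis (mono_tags) 0 empty_iff mem_Collect_eq minus_zero of_nat_0)
  next
    case (Suc N')
    have "\<not> (\<forall>z < - int N'. z \<in> X)"
      using not_less_Least[of N' "\<lambda>N. \<forall>z < - int N. z \<in> X"] Suc by (simp add: N_def)
    then obtain z where "z < - int N'" "z \<notin> X" by blast
    then have "z = - int N"
      using low[of z] Suc by force
    then show ?thesis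
      using \<open>z \<notin> X\<close> by simp
  qed
  define M where "M = {z \<in> X. - int N \<le> z}"
  have M_eq: "M = int ` bead_arms X \<union> ({- int N..<0} - (\<lambda>l. - 1 - int l) ` bead_legs X)"
  proof (intro equalityI subsetI)
    fix z assume z: "z \<in> M"
    show "z \<in> int ` bead_arms X \<union> ({- int N..<0} - (\<lambda>l. - 1 - int l) ` bead_legs X)"
    proof (cases "z \<ge> 0")
      case True
      then have "z = int (nat z)" "nat z \<in> bead_arms X"
        using z by (auto simp: M_def bead_arms_def)
      then show ?thesis by blast
    qed (use z in \<open>auto simp: M_def bead_legs_def\<close>)
  next
    fix z assume z: "z \<in> int ` bead_arms X \<union> ({- int N..<0} - (\<lambda>l. - 1 - int l) ` bead_legs X)"
    show "z \<in> M"
    proof (cases "z \<ge> 0")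
      case False
      then have z_eq: "z = - 1 - int (nat (- 1 - z))" and "- int N \<le> z"
        using z by auto
      moreover have "z \<notin> (\<lambda>l. - 1 - int l) ` bead_legs X"
        using z False by auto
      ultimately have "nat (- 1 - z) \<notin> bead_legs X"
        by (metis image_eqI)
      then show ?thesis
        using z_eq \<open>- int N \<le> z\<close> by (simp add: M_def bead_legs_def)
    qed (use z in \<open>auto simp: M_def bead_arms_def\<close>)
  qed
  have finM: "finite M"
    unfolding M_eq using fin by simp
  have cardM: "card M = N"
  proof -
    have sub: "(\<lambda>l. - 1 - int l) ` bead_legs X \<subseteq> {- int N..<0}"
      using low by (force simp: bead_legs_def)
    have "card M = card (int ` bead_arms X)
        + card ({- int N..<0} - (\<lambda>l. - 1 - int l) ` bead_legs X)"
      unfolding M_eq using fin by (intro card_Un_disjoint) auto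
    also have "card ({- int N..<0} - (\<lambda>l. - 1 - int l) ` bead_legs X)
        = N - card ((\<lambda>l. - 1 - int l) ` bead_legs X)"
      using sub fin by (subst card_Diff_subset) auto
    also have "card (int ` bead_arms X) = card (bead_arms X)"
      by (intro card_image) auto
    also have "card ((\<lambda>l. - 1 - int l) ` bead_legs X) = card (bead_legs X)"
      by (intro card_image) (auto simp: inj_on_def)
    also have "card (bead_legs X) \<le> N"
      using card_mono[OF _ sub] by (simp add: card_image inj_on_def)
    then have "card (bead_arms X) + (N - card (bead_legs X)) = N"
      using neutral by simp
    finally show ?thesis .
  qed
  define xs where "xs = rev (sorted_list_of_set M)"
  have len: "length xs = N" and set: "set xs = M"
    using finM cardM by (simp_all add: xs_def)
  have decreasing: "xs ! j < xs ! i" if "i < j" "j < N" for i j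
  proof -
    have "sorted_wrt (>) xs"
      by (simp add: xs_def sorted_wrt_rev)
    then show ?thesis
      using that len by (simp add: sorted_wrt_iff_nth_less)
  qed
  have steps: "xs ! (i + d) + int d \<le> xs ! i" if "i + d < N" for i d
    using that
  proof (induction d)
    case (Suc d)
    then show ?case
      using decreasing[of "i + d" "i + Suc d"] by simp
  qed simp
  have pos: "xs ! i + int i + 1 > 0" if "i < N" for i
  proof -
    have "xs ! (N - 1) \<in> M"
      using that len set by (metis diff_less gr_implies_not0 nth_mem zero_less_one neq0_conv)
    moreover have "xs ! (N - 1) \<noteq> - int N"
      using gap \<open>xs ! (N - 1) \<in> M\<close> by (auto simp: M_def)
    ultimately have "xs ! (N - 1) > - int N"
      by (simp add: M_def)
    moreover have "xs ! (N - 1) + int (N - 1 - i) \<le> xs ! i"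
      using steps[of i "N - 1 - i"] that by simp
    ultimately show ?thesis
      using that by linarith
  qed
  define \<mu> where "\<mu> = map (\<lambda>i. nat (xs ! i + int i + 1)) [0..<N]"
  have "integer_partition \<mu>"
  proof -
    have "xs ! j + int j \<le> xs ! i + int i" if "i < j" "j < N" for i j
      using steps[of i "j - i"] that by simp
    then have "sorted_wrt (\<ge>) \<mu>"
      by (auto simp: \<mu>_def sorted_wrt_iff_nth_less intro!: nat_mono)
    moreover have "0 \<notin> set \<mu>"
      using pos by (force simp: \<mu>_def)
    ultimately show ?thesis
      by (simp add: integer_partition_def)
  qed
  moreover have "beads \<mu> = X"
  proof -
    have bead: "int (row \<mu> i) - int i - 1 = (if i < N then xs ! i else - int i - 1)" for i
      using pos[of i] by (auto simp: row_def \<mu>_def)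
    show ?thesis
    proof (intro equalityI subsetI)
      fix z assume "z \<in> beads \<mu>"
      then obtain i where "z = (if i < N then xs ! i else - int i - 1)"
        unfolding beads_def bead by blast
      then show "z \<in> X"
        using low set len nth_mem[of i xs] by (auto simp: M_def split: if_splits)
    next
      fix z assume z: "z \<in> X"
      show "z \<in> beads \<mu>"
      proof (cases "- int N \<le> z")
        case True
        then have "z \<in> set xs"
          using z set by (simp add: M_def)
        then obtain i where "i < N" "z = xs ! i"
          using len by (auto simp: in_set_conv_nth)
        then show ?thesis
          unfolding beads_def bead by (intro image_eqI[of _ _ i]) auto
      next
        case False
        then show ?thesis
          unfolding beads_def bead by (intro image_eqI[of _ _ "nat (- 1 - z)"]) auto
      qed
    qed
  qed
  ultimately show thesis ..
qed

lemma ex_core_3_char_vector: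
  "\<exists>\<mu>. core 3 \<mu> \<and> char_vector \<mu> = (- x - y, x, y)"
proof -
  define c :: "nat \<Rightarrow> int" where "c i = (if i = 0 then - x - y else if i = 1 then x else y)" for i
  have "card (bead_arms (abacus c)) = card (bead_legs (abacus c))"
    using charge_abacus[of c] by (simp add: c_def)
  then obtain \<mu> where \<mu>: "integer_partition \<mu>" "beads \<mu> = abacus c"
    using partition_of_neutral_beads finite_bead_arms_legs by blast
  have "z - 3 \<in> abacus c" if "z \<in> abacus c" for z
  proof -
    have "(z - 3) mod 3 = z mod 3" "(z - 3) div 3 = z div 3 - 1"
      by presburger+
    then show ?thesis
      using that by (simp add: abacus_def)
  qed
  then have "core 3 \<mu>"
    using core_iff_beads[OF \<mu>(1)] \<mu>(2) by simp
  moreover have "char_vector \<mu> = (- x - y, x, y)"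
    using char_coord_abacus[OF \<mu>] by (simp add: char_vector_def c_def)
  ultimately show ?thesis by blast
qed

theorem char_vectors_of_size_eq:
  "char_vectors_of_size n = {(x, y). 3 * (x\<^sup>2 + x * y + y\<^sup>2) + x + 2 * y = int n}"
proof (intro equalityI subsetI)
  fix v assume "v \<in> char_vectors_of_size n"
  then show "v \<in> {(x, y). 3 * (x\<^sup>2 + x * y + y\<^sup>2) + x + 2 * y = int n}"
    using core_3_char_vector(2) by (auto simp: char_vectors_of_size_def cores_of_size_def)
next
  fix v assume "v \<in> {(x, y). 3 * (x\<^sup>2 + x * y + y\<^sup>2) + x + 2 * y = int n}"
  then obtain x y where v: "v = (x, y)" and size: "3 * (x\<^sup>2 + x * y + y\<^sup>2) + x + 2 * y = int n"
    by auto
  obtain \<mu> where \<mu>: "core 3 \<mu>" "char_vector \<mu> = (- x - y, x, y)"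
    using ex_core_3_char_vector by blast
  then have "sum_list \<mu> = n"
    using core_3_char_vector(2)[OF \<mu>] size by simp
  then show "v \<in> char_vectors_of_size n"
    using \<mu> by (auto simp: char_vectors_of_size_def cores_of_size_def v)
qed

section \<open>Eisenstein integers\<close>

text \<open>\<open>Eis a b\<close> stands for \<open>a + b \<omega>\<close> with \<open>\<omega>\<^sup>2 + \<omega> + 1 = 0\<close>.\<close>

datatype eisenstein = Eis (rat_part: int) (omega_part: int)

lemma eisenstein_eq_iff:
  "z = w \<longleftrightarrow> rat_part z = rat_part w \<and> omega_part z = omega_part w"
  by (cases z; cases w) auto

instantiation eisenstein :: comm_ring_1
begin

definition "0 = Eis 0 0"
definition "1 = Eis 1 0"
definition "z + w = Eis (rat_part z + rat_part w) (omega_part z + omega_part w)"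
definition "- z = Eis (- rat_part z) (- omega_part z)"
definition "z - w = Eis (rat_part z - rat_part w) (omega_part z - omega_part w)"
definition "z * w = Eis (rat_part z * rat_part w - omega_part z * omega_part w)
  (rat_part z * omega_part w + omega_part z * rat_part w - omega_part z * omega_part w)"

lemmas eisenstein_ops =
  zero_eisenstein_def one_eisenstein_def plus_eisenstein_def uminus_eisenstein_def
  minus_eisenstein_def times_eisenstein_def

instance
  by standard (simp_all add: eisenstein_ops eisenstein_eq_iff algebra_simps)

end

lemma eisenstein_parts [simp]:
  "rat_part 0 = 0" "omega_part 0 = 0"
  "rat_part 1 = 1" "omega_part 1 = 0"
  "rat_part (z + w) = rat_part z + rat_part w"
  "omega_part (z + w) = omega_part z + omega_part w"
  "rat_part (- z) = - rat_part z" "omega_part (- z) = - omega_part z"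
  "rat_part (z - w) = rat_part z - rat_part w"
  "omega_part (z - w) = omega_part z - omega_part w"
  "rat_part (z * w) = rat_part z * rat_part w - omega_part z * omega_part w"
  "omega_part (z * w) =
     rat_part z * omega_part w + omega_part z * rat_part w - omega_part z * omega_part w"
  by (simp_all add: eisenstein_ops)

lemma of_nat_eisenstein: "of_nat m = Eis (int m) 0"
  by (induction m) (simp_all add: eisenstein_eq_iff)

lemma of_int_eisenstein: "of_int m = Eis m 0"
  by (cases m rule: int_cases2) (simp_all add: of_nat_eisenstein eisenstein_eq_iff)

lemma of_int_eisenstein_parts [simp]:
  "rat_part (of_int m) = m" "omega_part (of_int m) = 0"
  by (simp_all add: of_int_eisenstein)

lemma numeral_eisenstein_parts [simp]:
  "rat_part (numeral m) = numeral m" "omega_part (numeral m) = 0"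
  using of_int_eisenstein_parts[of "numeral m"] by simp_all

definition eis_norm :: "eisenstein \<Rightarrow> int" where
  "eis_norm z = (rat_part z)\<^sup>2 - rat_part z * omega_part z + (omega_part z)\<^sup>2"

definition conjugate :: "eisenstein \<Rightarrow> eisenstein" where
  "conjugate z = Eis (rat_part z - omega_part z) (- omega_part z)"

lemma mult_conjugate: "z * conjugate z = of_int (eis_norm z)"
  by (simp add: eisenstein_eq_iff conjugate_def eis_norm_def power2_eq_square algebra_simps)

lemma eis_norm_mult: "eis_norm (z * w) = eis_norm z * eis_norm w"
  by (simp add: eis_norm_def power2_eq_square algebra_simps)

lemma eis_norm_conjugate [simp]: "eis_norm (conjugate z) = eis_norm z"
  by (simp add: eis_norm_def conjugate_def power2_eq_square algebra_simps)

lemma eis_norm_of_int [simp]: "eis_norm (of_int m) = m\<^sup>2"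
  by (simp add: eis_norm_def)

lemma four_eis_norm:
  "4 * eis_norm z = (2 * rat_part z - omega_part z)\<^sup>2 + 3 * (omega_part z)\<^sup>2"
  by (simp add: eis_norm_def power2_eq_square algebra_simps)

lemma eis_norm_nonneg [simp]: "0 \<le> eis_norm z"
  using four_eis_norm[of z] by (smt (verit) zero_le_power2)

lemma eis_norm_eq_0_iff [simp]: "eis_norm z = 0 \<longleftrightarrow> z = 0"
proof
  assume "eis_norm z = 0"
  then have sum0: "(2 * rat_part z - omega_part z)\<^sup>2 + 3 * (omega_part z)\<^sup>2 = 0"
    using four_eis_norm[of z] by simp
  then have "(omega_part z)\<^sup>2 = 0" "(2 * rat_part z - omega_part z)\<^sup>2 = 0"
    using zero_le_power2[of "omega_part z"] zero_le_power2[of "2 * rat_part z - omega_part z"]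
    by linarith+
  then show "z = 0"
    by (simp add: eisenstein_eq_iff)
qed (simp add: eis_norm_def)

instance eisenstein :: idom
proof
  fix z w :: eisenstein
  assume "z \<noteq> 0" "w \<noteq> 0"
  then have "eis_norm (z * w) \<noteq> 0"
    by (simp add: eis_norm_mult del: eis_norm_eq_0_iff) simp
  then show "z * w \<noteq> 0"
    by simp
qed

lemma nearest_multiple:
  fixes a m :: int
  assumes "m > 0"
  obtains q where "2 * \<bar>a - q * m\<bar> \<le> m"
proof -
  define k r where "k = (2 * a + m) div (2 * m)" and "r = (2 * a + m) mod (2 * m)"
  have "0 \<le> r" "r < 2 * m"
    using assms by (simp_all add: r_def)
  moreover have "k * (2 * m) + r = 2 * a + m"
    unfolding k_def r_def by (rule div_mult_mod_eq)
  then have "2 * (a - k * m) = r - m"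
    by (simp add: algebra_simps)
  ultimately have "2 * \<bar>a - k * m\<bar> \<le> m"
    by linarith
  then show thesis ..
qed

text \<open>Round both coordinates of the exact quotient \<open>s / d\<close> to nearest integers. The error
  \<open>(r, r')\<close> has coordinates at most 1/2 in absolute value, so its norm
  \<open>r\<^sup>2 - r r' + r'\<^sup>2\<close> is at most 3/4. Multiplying through by \<open>eis_norm d\<close> keeps
  the computation in the integers.\<close>

lemma eisenstein_division:
  assumes "d \<noteq> 0"
  obtains q where "eis_norm (s - q * d) < eis_norm d"
proof -
  define m where "m = eis_norm d"
  have m: "m > 0"
    using assms eis_norm_nonneg[of d] by (simp add: m_def order.strict_iff_order)
  define t where "t = s * conjugate d"
  obtain q1 where q1: "2 * \<bar>rat_part t - q1 * m\<bar> \<le> m"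
    using nearest_multiple[OF m] .
  obtain q2 where q2: "2 * \<bar>omega_part t - q2 * m\<bar> \<le> m"
    using nearest_multiple[OF m] .
  define q where "q = Eis q1 q2"
  define r1 r2 where "r1 = rat_part t - q1 * m" and "r2 = omega_part t - q2 * m"
  have "(s - q * d) * conjugate d = t - q * of_int m"
    by (simp add: t_def m_def algebra_simps flip: mult_conjugate)
  then have "eis_norm (s - q * d) * m = eis_norm (t - q * of_int m)"
    by (metis eis_norm_conjugate eis_norm_mult m_def)
  also have "\<dots> = r1\<^sup>2 - r1 * r2 + r2\<^sup>2"
    by (simp add: eis_norm_def q_def r1_def r2_def)
  also have "4 * \<dots> \<le> 3 * m\<^sup>2"
  proof -
    have "\<bar>2 * r1\<bar> \<le> \<bar>m\<bar>" "\<bar>2 * r2\<bar> \<le> \<bar>m\<bar>"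
      using q1 q2 m unfolding r1_def[symmetric] r2_def[symmetric] by (simp_all add: abs_mult)
    then have "(2 * r1)\<^sup>2 \<le> m\<^sup>2" "(2 * r2)\<^sup>2 \<le> m\<^sup>2"
      and "\<bar>2 * r1\<bar> * \<bar>2 * r2\<bar> \<le> \<bar>m\<bar> * \<bar>m\<bar>"
      by (simp_all only: abs_le_square_iff mult_mono abs_ge_zero)
    moreover have "- (4 * (r1 * r2)) \<le> \<bar>2 * r1\<bar> * \<bar>2 * r2\<bar>"
      by (simp add: abs_mult[symmetric])
    ultimately show ?thesis
      by (simp add: power2_eq_square algebra_simps)
  qed
  also have "3 * m\<^sup>2 < 4 * (m * m)"
    using m by (simp add: power2_eq_square)
  finally have "eis_norm (s - q * d) < m"
    using m by (simp add: mult.commute)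
  then show thesis
    unfolding m_def ..
qed

lemma eisenstein_bezout:
  fixes a b :: eisenstein
  shows "\<exists>d p q. d = a * p + b * q \<and> d dvd a \<and> d dvd b"
proof (induction "nat (eis_norm b)" arbitrary: a b rule: less_induct)
  case less
  show ?case
  proof (cases "b = 0")
    case True
    then show ?thesis
      by (intro exI[of _ a] exI[of _ 1] exI[of _ 0]) simp
  next
    case False
    then obtain q where "eis_norm (a - q * b) < eis_norm b"
      using eisenstein_division by blast
    then have "nat (eis_norm (a - q * b)) < nat (eis_norm b)"
      using eis_norm_nonneg[of "a - q * b"] by linarith
    then obtain d p s where d: "d = b * p + (a - q * b) * s" "d dvd b" "d dvd a - q * b"
      using less by blast
    have "d dvd (a - q * b) + q * b"
      using d by (intro dvd_add dvd_mult)
    moreover have "d = a * s + b * (p - q * s)"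
      using d(1) by (simp add: algebra_simps)
    ultimately show ?thesis
      using d(2) by auto
  qed
qed

lemma of_int_dvd_eisenstein_iff:
  "(of_int m :: eisenstein) dvd of_int k \<longleftrightarrow> m dvd k"
proof
  assume "(of_int m :: eisenstein) dvd of_int k"
  then obtain t where t: "of_int k = of_int m * (t :: eisenstein)" ..
  show "m dvd k"
    using arg_cong[OF t, of rat_part] by simp
qed auto

lemma eis_norm_dvd: "z dvd w \<Longrightarrow> eis_norm z dvd eis_norm w"
  by (auto simp: eis_norm_mult elim!: dvdE)

text \<open>The factor \<open>d\<close> is a greatest common divisor of \<open>w\<close> and \<open>A\<close>. Expanding the norm of
  the combination \<open>w p + A q\<close> shows that \<open>A\<close> divides \<open>eis_norm d\<close>. The cofactor
  \<open>m\<close> divides \<open>A\<close> (because \<open>d\<close> divides \<open>A\<close>, of norm \<open>A\<^sup>2\<close>) and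
  \<open>B\<close> (because \<open>d\<close> divides \<open>w\<close>, of norm \<open>A B\<close>), so it is 1.\<close>

lemma factor_of_coprime_norms:
  assumes norm_w: "eis_norm w = A * B" and coprime: "coprime A B" and pos: "A > 0"
  obtains d e where "w = d * e" "eis_norm d = A" "eis_norm e = B"
proof -
  obtain d p q where d: "d = w * p + of_int A * q" and dvd: "d dvd w" "d dvd of_int A"
    using eisenstein_bezout by blast
  obtain e where e: "w = d * e"
    using dvd(1) ..
  have "of_int (eis_norm d) = d * conjugate d"
    by (simp add: mult_conjugate)
  also have "conjugate d = conjugate w * conjugate p + of_int A * conjugate q"
    by (simp add: d conjugate_def eisenstein_eq_iff algebra_simps)
  also have "d * \<dots> = w * conjugate w * (p * conjugate p)
      + of_int A * (q * conjugate w * conjugate p + w * p * conjugate q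
                    + of_int A * q * conjugate q)"
    by (simp add: d algebra_simps)
  also have "w * conjugate w = of_int A * of_int B"
    by (simp add: mult_conjugate norm_w)
  finally have "of_int (eis_norm d) = of_int A * (of_int B * (p * conjugate p)
      + (q * conjugate w * conjugate p + w * p * conjugate q + of_int A * q * conjugate q))"
    by (simp add: algebra_simps)
  then have "A dvd eis_norm d"
    by (metis dvd_triv_left of_int_dvd_eisenstein_iff)
  then obtain m where m: "eis_norm d = A * m" ..
  have "A * m dvd A * A"
    using eis_norm_dvd[OF dvd(2)] m by (simp add: power2_eq_square)
  then have "m dvd A"
    using pos by simp
  moreover have "A * B = A * (m * eis_norm e)"
    using norm_w e m by (metis eis_norm_mult mult.assoc)
  then have B: "B = m * eis_norm e"
    using pos by auto
  ultimately have "is_unit m"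
    using coprime by (meson coprime_common_divisor dvd_triv_left)
  moreover have "m \<ge> 0"
    using m pos eis_norm_nonneg[of d] by (simp add: zero_le_mult_iff)
  ultimately have "m = 1"
    by (simp add: zdvd1_eq)
  then show thesis
    using that e m B by simp
qed

text \<open>Among the usual normalisations the residue 1 is chosen because it is closed under
  multiplication.\<close>

definition primary :: "eisenstein \<Rightarrow> bool" where
  "primary z \<longleftrightarrow> 3 dvd z - 1"

lemma primary_iff: "primary z \<longleftrightarrow> rat_part z mod 3 = 1 \<and> omega_part z mod 3 = 0"
proof -
  have "(3::eisenstein) dvd w \<longleftrightarrow> 3 dvd rat_part w \<and> 3 dvd omega_part w" for w
  proof
    assume "3 dvd rat_part w \<and> 3 dvd omega_part w"
    then obtain a b where "rat_part w = 3 * a" "omega_part w = 3 * b"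
      by (auto elim!: dvdE)
    then have "w = 3 * Eis a b"
      by (simp add: eisenstein_eq_iff)
    then show "3 dvd w" ..
  qed (auto elim!: dvdE)
  then show ?thesis
    unfolding primary_def by simp presburger
qed

lemma primary_mult: "primary z \<Longrightarrow> primary w \<Longrightarrow> primary (z * w)"
proof -
  assume "primary z" "primary w"
  then have "3 dvd (z - 1) * w + (w - 1)"
    unfolding primary_def by (intro dvd_add dvd_mult2)
  then show ?thesis
    by (simp add: primary_def algebra_simps)
qed

lemma primary_cofactor: "primary z \<Longrightarrow> primary (z * w) \<Longrightarrow> primary w"
proof -
  assume "primary z" "primary (z * w)"
  then have "3 dvd (z * w - 1) - (z - 1) * w"
    unfolding primary_def using dvd_diff dvd_mult2 by blast
  then show ?thesis
    by (simp add: primary_def algebra_simps)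
qed

text \<open>Modulo 3 the norm \<open>a\<^sup>2 - a b + b\<^sup>2\<close> is \<open>(a + b)\<^sup>2\<close>, so the elements of norm prime
  to 3 fall into the six residue classes with \<open>a + b\<close> not divisible by 3. These are the classes of the
  six units.\<close>

lemma primary_associate:
  assumes "\<not> 3 dvd eis_norm z"
  obtains u v where "u * v = 1" "primary (u * z)"
proof -
  define a b where "a = rat_part z" and "b = omega_part z"
  have "eis_norm z = (a + b)\<^sup>2 - 3 * (a * b)"
    by (simp add: eis_norm_def a_def b_def power2_eq_square algebra_simps)
  with assms have "\<not> 3 dvd (a + b)\<^sup>2"
    by (metis dvd_diff dvd_triv_left)
  then have "\<not> 3 dvd a + b"
    by (auto simp: power2_eq_square intro: dvd_mult2)
  then consider
      "a mod 3 = 1 \<and> b mod 3 = 0" | "a mod 3 = 2 \<and> b mod 3 = 0"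
    | "a mod 3 = 0 \<and> b mod 3 = 1" | "a mod 3 = 0 \<and> b mod 3 = 2"
    | "a mod 3 = 1 \<and> b mod 3 = 1" | "a mod 3 = 2 \<and> b mod 3 = 2"
    by atomize_elim presburger
  then have "\<exists>u v. u * v = 1 \<and> primary (u * z)"
  proof cases
    case 1 then show ?thesis
      by (intro exI[of _ 1] exI[of _ 1]) (auto simp: primary_iff a_def b_def)
  next
    case 2 then show ?thesis
      by (intro exI[of _ "-1"] exI[of _ "-1"]) (simp add: primary_iff a_def b_def; presburger)
  next
    case 3 then show ?thesis
      by (intro exI[of _ "Eis (-1) (-1)"] exI[of _ "Eis 0 1"])
        (simp add: primary_iff a_def b_def eisenstein_eq_iff; presburger)
  next
    case 4 then show ?thesis
      by (intro exI[of _ "Eis 1 1"] exI[of _ "Eis 0 (-1)"])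
        (simp add: primary_iff a_def b_def eisenstein_eq_iff; presburger)
  next
    case 5 then show ?thesis
      by (intro exI[of _ "Eis 0 (-1)"] exI[of _ "Eis 1 1"])
        (simp add: primary_iff a_def b_def eisenstein_eq_iff; presburger)
  next
    case 6 then show ?thesis
      by (intro exI[of _ "Eis 0 1"] exI[of _ "Eis (-1) (-1)"])
        (simp add: primary_iff a_def b_def eisenstein_eq_iff; presburger)
  qed
  then show thesis
    using that by blast
qed

text \<open>An element of norm 1 is one of the six units, which lie in distinct classes modulo 3.\<close>

lemma primary_unit:
  assumes "primary z" "eis_norm z = 1"
  shows "z = 1"
proof -
  have le: "(2 * rat_part z - omega_part z)\<^sup>2 + 3 * (omega_part z)\<^sup>2 = 4"
    using four_eis_norm[of z] assms(2) by simp
  then have "3 * (omega_part z)\<^sup>2 \<le> 4"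
    by (smt (verit) zero_le_power2)
  then have "(omega_part z)\<^sup>2 < 2\<^sup>2"
    by simp
  then have "\<bar>omega_part z\<bar> < 2"
    using power2_less_imp_less[of "\<bar>omega_part z\<bar>" 2] by simp
  moreover have "omega_part z mod 3 = 0"
    using assms(1) by (simp add: primary_iff)
  ultimately have om: "omega_part z = 0"
    by presburger
  then have "(rat_part z)\<^sup>2 = 1"
    using assms(2) by (simp add: eis_norm_def)
  then have "rat_part z = 1 \<or> rat_part z = -1"
    by (simp add: power2_eq_1_iff)
  then show ?thesis
    using om assms(1) by (auto simp: primary_iff eisenstein_eq_iff)
qed

definition primary_of_norm :: "int \<Rightarrow> eisenstein set" where
  "primary_of_norm m = {z. primary z \<and> eis_norm z = m}"

text \<open>Surjectivity adjusts the factors given by \<open>factor_of_coprime_norms\<close> by inverse units so that the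
  first becomes primary; the second is then primary too, since primary elements are those congruent to 1
  modulo 3. For injectivity let \<open>z w = z' w'\<close>. Since \<open>A = z * conjugate z\<close> and
  \<open>B = w' * conjugate w'\<close> are coprime integers, a Bezout relation between them shows that
  \<open>z\<close> divides \<open>z'\<close>. The quotient is primary of norm 1, hence 1.\<close>

theorem bij_betw_primary_mult:
  assumes coprime: "coprime A B" and pos: "A > 0" "B > 0" and ndvd: "\<not> 3 dvd A"
  shows "bij_betw (\<lambda>(z, w). z * w) (primary_of_norm A \<times> primary_of_norm B)
           (primary_of_norm (A * B))"
proof (rule bij_betw_imageI)
  show "inj_on (\<lambda>(z, w). z * w) (primary_of_norm A \<times> primary_of_norm B)"
  proof (rule inj_onI, unfold case_prod_unfold)
    fix p p'
    assume p: "p \<in> primary_of_norm A \<times> primary_of_norm B"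
      and p': "p' \<in> primary_of_norm A \<times> primary_of_norm B"
      and prod: "fst p * snd p = fst p' * snd p'"
    define z w z' w' where "z = fst p" and "w = snd p" and "z' = fst p'" and "w' = snd p'"
    note components = z_def w_def z'_def w'_def
    have z: "primary z" and z': "primary z'" and norm_z': "eis_norm z' = eis_norm z"
      and A: "A = eis_norm z" and B: "B = eis_norm w'" and eq: "z * w = z' * w'"
      using p p' prod by (auto simp: primary_of_norm_def components)
    obtain s t where st: "A * s + B * t = 1"
      using coprime bezout_int[of A B] by (auto simp: mult.commute)
    have "z' = z' * of_int (A * s + B * t)"
      by (simp add: st)
    also have "\<dots> = z' * (z * conjugate z) * of_int s + (z' * w') * conjugate w' * of_int t"
      by (simp add: A B mult_conjugate algebra_simps)
    also have "\<dots> = z * (z' * conjugate z * of_int s + w * conjugate w' * of_int t)"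
      unfolding eq[symmetric] by (simp add: algebra_simps)
    finally obtain q where q: "z' = z * q" by blast
    have "A * eis_norm q = A * 1"
      using norm_z' A q by (simp add: eis_norm_mult)
    then have "eis_norm q = 1"
      using pos by simp
    moreover have "primary q"
      using z z' q primary_cofactor by blast
    ultimately have "q = 1"
      by (rule primary_unit[rotated])
    with q have "z' = z"
      by simp
    moreover have "z \<noteq> 0"
      using pos A by (metis eis_norm_eq_0_iff less_irrefl)
    ultimately have "z = z' \<and> w = w'"
      using eq by simp
    then show "p = p'"
      by (simp add: components prod_eq_iff)
  qed
next
  show "(\<lambda>(z, w). z * w) ` (primary_of_norm A \<times> primary_of_norm B) = primary_of_norm (A * B)"
  proof (intro equalityI subsetI)
    fix x assume "x \<in> primary_of_norm (A * B)"
    then have x: "primary x" "eis_norm x = A * B"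
      by (simp_all add: primary_of_norm_def)
    obtain d e where de: "x = d * e" "eis_norm d = A" "eis_norm e = B"
      using factor_of_coprime_norms[OF x(2) coprime pos(1)] .
    obtain u v where uv: "u * v = 1" "primary (u * d)"
      using primary_associate ndvd de(2) by metis
    have norms: "eis_norm u * eis_norm v = 1"
      using uv(1) by (metis eis_norm_mult eis_norm_of_int of_int_1 one_power2)
    then have norm_uv: "eis_norm u = 1" "eis_norm v = 1"
      using eis_norm_nonneg[of u] eis_norm_nonneg[of v]
      by (smt (verit) zmult_eq_1_iff)+
    have prod: "x = (u * d) * (v * e)"
      using uv(1) de(1) by (metis mult.assoc mult.left_commute mult_1)
    then have "primary (v * e)"
      using primary_cofactor uv(2) x(1) by blast
    then have "(u * d, v * e) \<in> primary_of_norm A \<times> primary_of_norm B"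
      using uv(2) de norm_uv by (simp add: primary_of_norm_def eis_norm_mult)
    then show "x \<in> (\<lambda>(z, w). z * w) ` (primary_of_norm A \<times> primary_of_norm B)"
      using prod by force
  qed (auto simp: primary_of_norm_def eis_norm_mult primary_mult)
qed

section \<open>The composition of characteristic vectors\<close>

text \<open>The vector \<open>(x, y)\<close> becomes \<open>1 + 3 (y - x \<omega>)\<close>, which turns the size formula into a
  norm.\<close>

definition eisenstein_of_vector :: "int \<times> int \<Rightarrow> eisenstein" where
  "eisenstein_of_vector v = Eis (3 * snd v + 1) (- 3 * fst v)"

lemma inj_eisenstein_of_vector: "inj eisenstein_of_vector"
  by (auto simp: inj_def eisenstein_of_vector_def)

lemma eisenstein_of_vector_in_primary_of_norm_iff:
  "eisenstein_of_vector v \<in> primary_of_norm (3 * int n + 1) \<longleftrightarrow> v \<in> char_vectors_of_size n"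
proof -
  obtain x y where v: "v = (x, y)" by (cases v)
  have "eis_norm (eisenstein_of_vector v) = 3 * (3 * (x\<^sup>2 + x * y + y\<^sup>2) + x + 2 * y) + 1"
    by (simp add: v eisenstein_of_vector_def eis_norm_def power2_eq_square algebra_simps)
  moreover have "primary (eisenstein_of_vector v)"
    by (simp add: primary_iff eisenstein_of_vector_def)
  ultimately show ?thesis
    by (auto simp: primary_of_norm_def char_vectors_of_size_eq v)
qed

lemma primary_imp_eisenstein_of_vector:
  assumes "primary z"
  obtains v where "z = eisenstein_of_vector v"
proof
  show "z = eisenstein_of_vector (- (omega_part z div 3), rat_part z div 3)"
    using assms by (simp add: primary_iff eisenstein_of_vector_def eisenstein_eq_iff) presburger
qed

lemma bij_betw_eisenstein_of_vector:
  "bij_betw eisenstein_of_vector (char_vectors_of_size n) (primary_of_norm (3 * int n + 1))"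
proof (rule bij_betw_imageI)
  show "eisenstein_of_vector ` char_vectors_of_size n = primary_of_norm (3 * int n + 1)"
  proof (intro equalityI subsetI)
    fix z assume z: "z \<in> primary_of_norm (3 * int n + 1)"
    then obtain v where "z = eisenstein_of_vector v"
      using primary_imp_eisenstein_of_vector by (auto simp: primary_of_norm_def)
    then show "z \<in> eisenstein_of_vector ` char_vectors_of_size n"
      using z by (simp add: eisenstein_of_vector_in_primary_of_norm_iff)
  qed (auto simp: eisenstein_of_vector_in_primary_of_norm_iff)
qed (use inj_eisenstein_of_vector in \<open>auto intro: inj_on_subset\<close>)

theorem mainTheorem5:
  fixes n k :: nat
  assumes "n \<ge> 1"
    and "a3 n \<noteq> 0"
    and "a3 (n + 3 ^ k) \<noteq> 0"
  shows "bij_betw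
           (\<lambda>((x, y), (x', y')).
              (x + x' + 3 * x * x' + 3 * x * y' + 3 * y * x',
               y + y' - 3 * x * x' + 3 * y * y'))
           (char_vectors_of_size n \<times> char_vectors_of_size (n + 3 ^ k))
           (char_vectors_of_size (3 * n ^ 2 + (3 ^ (k + 1) + 2) * n + 3 ^ k))"
proof -
  let ?C = "char_vectors_of_size n \<times> char_vectors_of_size (n + 3 ^ k)"
  let ?size = "3 * n ^ 2 + (3 ^ (k + 1) + 2) * n + 3 ^ k"
  let ?\<alpha> = "\<lambda>((x, y), (x', y')).
    (x + x' + 3 * x * x' + 3 * x * y' + 3 * y * x', y + y' - 3 * x * x' + 3 * y * y') :: int \<times> int"
  let ?e = eisenstein_of_vector
  define A B where "A = 3 * int n + 1" and "B = 3 * int (n + 3 ^ k) + 1"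
  have B: "B = A + 3 ^ (k + 1)"
    by (simp add: A_def B_def)
  have "coprime A 3"
  proof (rule coprimeI)
    fix c assume "c dvd A" "c dvd 3"
    then have "c dvd A - 3 * int n"
      by (intro dvd_diff dvd_mult2)
    then show "is_unit c"
      by (simp add: A_def)
  qed
  then have "coprime A (3 ^ (k + 1))"
    by simp
  then have "coprime A B"
    by (simp only: B coprime_iff_gcd_eq_1 gcd_add2)
  moreover have "\<not> 3 dvd A" "A > 0" "B > 0"
    unfolding A_def B_def by presburger+
  ultimately have mult: "bij_betw (\<lambda>(z, w). z * w) (primary_of_norm A \<times> primary_of_norm B)
      (primary_of_norm (A * B))"
    by (intro bij_betw_primary_mult)
  have "A * B = 3 * int ?size + 1"
    by (simp add: A_def B_def power2_eq_square algebra_simps)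
  moreover have "bij_betw (map_prod ?e ?e) ?C (primary_of_norm A \<times> primary_of_norm B)"
    unfolding A_def B_def by (intro bij_betw_map_prod bij_betw_eisenstein_of_vector)
  ultimately have "bij_betw ((\<lambda>(z, w). z * w) \<circ> map_prod ?e ?e) ?C
      (primary_of_norm (3 * int ?size + 1))"
    using mult bij_betw_trans by metis
  \<comment> \<open>The formula for \<open>\<alpha>\<close> is Eisenstein multiplication in disguise.\<close>
  moreover have "(\<lambda>(z, w). z * w) \<circ> map_prod ?e ?e = ?e \<circ> ?\<alpha>"
    by (auto simp: fun_eq_iff eisenstein_of_vector_def eisenstein_eq_iff algebra_simps)
  ultimately have comp: "bij_betw (?e \<circ> ?\<alpha>) ?C (primary_of_norm (3 * int ?size + 1))"
    by simp
  have "?\<alpha> p \<in> char_vectors_of_size ?size" if "p \<in> ?C" for p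
    using bij_betw_apply[OF comp that] unfolding comp_def
    by (simp only: eisenstein_of_vector_in_primary_of_norm_iff)
  then have "?\<alpha> ` ?C \<subseteq> char_vectors_of_size ?size"
    by blast
  then show ?thesis
    using bij_betw_comp_iff2[OF bij_betw_eisenstein_of_vector[of ?size]] comp by blast
qed

end
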